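(* Let $T$ be a tree of order $n$ having $\varepsilon(T)$ leaves. For any positive integer $t$, the number of leaves of $S(T,t)$ is $$\varepsilon(S(T,t))=\frac{\varepsilon(T)\left(n^t-2n^{t-1}+1\right)}{n-1}.$$
   Context: A leaf of a tree is a vertex of degree one; $\varepsilon(T)$ denotes the number of leaves of a tree $T$. For a graph $G=(V,E)$ and a positive integer $t$, $V^t$ denotes the set of words $u=u_1u_2\cdots u_t$ of length $t$ over the alphabet $V$. The generalized Sierpiński graph $S(G,t)$ has vertex set $V^t$, and $\{u,v\}$ is an edge if and only if there is $i\in\{1,\dots,t\}$ such that: (i) $u_j=v_j$ for all $j<i$; (ii) $u_i\ne v_i$ and $\{u_i,v_i\}\in E$; (iii) $u_j=v_i$ and $v_j=u_i$ for all $j>i$. *)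

theory Defs
  imports "Graph_Theory.Graph_Theory"
begin

text \<open>
  A finite simple undirected graph is a \<^locale>\<open>pair_graph\<close>: each edge \<open>{u, v}\<close> is represented by
  the two arcs \<open>(u, v)\<close> and \<open>(v, u)\<close>, so the degree of a vertex is its out-degree.

  The library constants \<open>forest\<close> and \<open>tree\<close> are not usable in this encoding, because the closed
  walk \<open>u, v, u\<close> counts as a \<open>cycle\<close> there. A cycle of the undirected graph is a \<open>cycle\<close> of length
  at least 3. The predicate \<open>connected\<close> of the library excludes the graph without vertices.
\<close>

definition undirected_tree :: "'a pair_pre_digraph \<Rightarrow> bool" where
  "undirected_tree T \<longleftrightarrow>
     pair_graph T \<and> connected (with_proj T) \<and>
     \<not> (\<exists>p. pre_digraph.cycle (with_proj T) p \<and> 3 \<le> length p)"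

definition leaves :: "'a pair_pre_digraph \<Rightarrow> 'a set" where
  "leaves G = {v \<in> pverts G. out_degree (with_proj G) v = 1}"

definition num_leaves :: "'a pair_pre_digraph \<Rightarrow> nat" where
  "num_leaves G = card (leaves G)"

text \<open>Words over \<open>V\<close> are lists; positions are counted from 0 instead of 1.\<close>

definition words :: "'a set \<Rightarrow> nat \<Rightarrow> 'a list set" where
  "words V t = {u. length u = t \<and> set u \<subseteq> V}"

definition sierpinski :: "'a pair_pre_digraph \<Rightarrow> nat \<Rightarrow> 'a list pair_pre_digraph" where
  "sierpinski G t =
     \<lparr> pverts = words (pverts G) t,
       parcs = {(u, v). u \<in> words (pverts G) t \<and> v \<in> words (pverts G) t \<and>
         (\<exists>i<t. (\<forall>j<i. u ! j = v ! j) \<and>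
                u ! i \<noteq> v ! i \<and> (u ! i, v ! i) \<in> parcs G \<and>
                (\<forall>j. i < j \<and> j < t \<longrightarrow> u ! j = v ! i \<and> v ! j = u ! i))} \<rparr>"

lemma finite_words: "finite V \<Longrightarrow> finite (words V t)"
  unfolding words_def using finite_lists_length_eq[of V t] by (simp add: conj_commute)

lemma pair_graph_sierpinski:
  assumes "pair_graph G"
  shows "pair_graph (sierpinski G t)"
proof -
  interpret pair_graph G by fact
  have fin: "finite (words (pverts G) t)"
    by (rule finite_words) (rule pair_finite_verts)
  have arcs: "parcs (sierpinski G t) \<subseteq> words (pverts G) t \<times> words (pverts G) t"
    by (auto simp: sierpinski_def)
  have sym_G: "(b, a) \<in> parcs G" if "(a, b) \<in> parcs G" for a b
    using pair_sym_arcs that by (auto simp: symmetric_def sym_def)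
  have wf: "pair_wf_digraph (sierpinski G t)"
    by unfold_locales (auto simp: sierpinski_def)
  have sym: "sym (parcs (sierpinski G t))"
  proof (rule symI)
    fix u v assume "(u, v) \<in> parcs (sierpinski G t)"
    then obtain i where "u \<in> words (pverts G) t" "v \<in> words (pverts G) t" "i < t"
      "\<forall>j<i. u ! j = v ! j" "u ! i \<noteq> v ! i" "(u ! i, v ! i) \<in> parcs G"
      "\<forall>j. i < j \<and> j < t \<longrightarrow> u ! j = v ! i \<and> v ! j = u ! i"
      unfolding sierpinski_def pair_pre_digraph.simps mem_Collect_eq prod.case by blast
    then have "v \<in> words (pverts G) t \<and> u \<in> words (pverts G) t \<and>
      (\<exists>i<t. (\<forall>j<i. v ! j = u ! j) \<and> v ! i \<noteq> u ! i \<and> (v ! i, u ! i) \<in> parcs G \<and>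
             (\<forall>j. i < j \<and> j < t \<longrightarrow> v ! j = u ! i \<and> u ! j = v ! i))"
      using sym_G by metis
    then show "(v, u) \<in> parcs (sierpinski G t)"
      unfolding sierpinski_def pair_pre_digraph.simps mem_Collect_eq prod.case .
  qed
  have ends: "arcs_ends (with_proj (sierpinski G t)) = parcs (sierpinski G t)"
    by (auto simp: arcs_ends_def arc_to_ends_def image_iff)
  have loopfree: "fst e \<noteq> snd e" if "e \<in> parcs (sierpinski G t)" for e
    using that
    unfolding sierpinski_def pair_pre_digraph.simps mem_Collect_eq case_prod_beta by metis
  have fin_verts: "finite (pverts (sierpinski G t))"
    using fin by (simp add: sierpinski_def)
  have fin_arcs: "finite (parcs (sierpinski G t))"
    using arcs finite_cartesian_product[OF fin fin] by (rule finite_subset)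
  have symm: "symmetric (with_proj (sierpinski G t))"
    using sym by (simp only: symmetric_def ends)
  interpret S: pair_wf_digraph "sierpinski G t" by (rule wf)
  show ?thesis
    apply unfold_locales
    subgoal by (rule fin_verts)
    subgoal by (rule fin_arcs)
    subgoal by (erule loopfree)
    subgoal by (rule symm)
    done
qed

end

theory Submission
  imports Defs
begin

text \<open>
  In \<open>S(G, t + 1)\<close> the word \<open>x # u\<close> keeps the neighbours of \<open>u\<close> in its copy of \<open>S(G, t)\<close>, and it
  has one further neighbour if and only if \<open>u\<close> is a constant word \<open>y \<dots> y\<close> with \<open>y\<close> adjacent to
  \<open>x\<close>. The constant word \<open>y \<dots> y\<close> has the degree of \<open>y\<close> in \<open>G\<close>, so the new arcs destroy exactly
  one leaf \<open>x # y \<dots> y\<close> for each leaf \<open>y\<close> of \<open>G\<close> and create none. Thus the number \<open>L t\<close> of leaves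
  satisfies \<open>L (t + 1) = n * L t - L 1\<close>.
\<close>

section \<open>Out-degrees and words\<close>

lemma out_degree_with_proj:
  "out_degree (with_proj G) v = card {w. (v, w) \<in> parcs G}"
proof -
  have "out_arcs (with_proj G) v = Pair v ` {w. (v, w) \<in> parcs G}"
    by (auto simp: out_arcs_def)
  then show ?thesis
    by (simp add: out_degree_def card_image inj_on_def)
qed

lemma Cons_in_words_Suc: "x # u \<in> words V (Suc t) \<longleftrightarrow> x \<in> V \<and> u \<in> words V t"
  by (auto simp: words_def)

lemma words_Suc: "words V (Suc t) = (\<lambda>(x, u). x # u) ` (V \<times> words V t)"
  by (auto simp: words_def length_Suc_conv image_iff)

lemma pverts_sierpinski: "pverts (sierpinski G t) = words (pverts G) t"
  by (simp add: sierpinski_def)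

lemma replicate_in_words: "y \<in> V \<Longrightarrow> replicate t y \<in> words V t"
  by (auto simp: words_def)

section \<open>Arcs, degrees and leaves when a letter is prepended\<close>

context pair_graph
begin

lemma finite_neighbours: "finite {w. (v, w) \<in> parcs G}"
  by (rule finite_subset[OF _ pair_finite_verts]) (auto dest: in_arcsD2)

lemma arc_commute: "(a, b) \<in> parcs G \<longleftrightarrow> (b, a) \<in> parcs G"
  using pair_sym_arcs by (auto simp: symmetric_def sym_def)

text \<open>Split by the first position where the words differ: a later position is an arc between
  the tails, while position 0 forces both tails to be constant.\<close>

lemma Cons_parcs_sierpinski_Suc:
  "(x # u, y # v) \<in> parcs (sierpinski G (Suc t)) \<longleftrightarrow>
     x \<in> pverts G \<and> x = y \<and> (u, v) \<in> parcs (sierpinski G t) \<or>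
     (x, y) \<in> parcs G \<and> u = replicate t y \<and> v = replicate t x"
    (is "_ \<longleftrightarrow> ?rhs")
proof (cases "length u = t \<and> length v = t")
  case True
  have shift: "(\<forall>j. m < j \<and> j < Suc t \<longrightarrow> P j) \<longleftrightarrow> (\<forall>j. m \<le> j \<and> j < t \<longrightarrow> P (Suc j))"
    for m P
  proof (intro iffI allI impI)
    fix j
    assume "\<forall>j. m \<le> j \<and> j < t \<longrightarrow> P (Suc j)" "m < j \<and> j < Suc t"
    then show "P j" by (cases j) auto
  qed auto
  have const: "u = replicate t y \<and> v = replicate t x \<longleftrightarrow>
      (\<forall>j. j < t \<longrightarrow> u ! j = y \<and> v ! j = x)"
    using True by (auto simp: list_eq_iff_nth_eq)
  \<comment> \<open>The adjacency condition at a fixed position \<open>i\<close>. Its bound is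
    \<open>length w\<close>, so one \<open>Q\<close> serves both \<open>Suc t\<close> and
    \<open>t\<close>.\<close>
  define Q where "Q w z i \<longleftrightarrow> (\<forall>j<i. w ! j = z ! j) \<and>
      w ! i \<noteq> z ! i \<and> (w ! i, z ! i) \<in> parcs G \<and>
      (\<forall>j. i < j \<and> j < length w \<longrightarrow> w ! j = z ! i \<and> z ! j = w ! i)" for w z i
  have sierp: "(w, z) \<in> parcs (sierpinski G m) \<longleftrightarrow>
      w \<in> words (pverts G) m \<and> z \<in> words (pverts G) m \<and> (\<exists>i<m. Q w z i)"
    if "length w = m" for w z m
    using that by (simp add: sierpinski_def Q_def)
  have Q_Suc: "Q (x # u) (y # v) (Suc i) \<longleftrightarrow> x = y \<and> Q u v i" for i
    using True by (auto simp: Q_def All_less_Suc2 shift Suc_le_eq)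
  have "x \<noteq> y" if "(x, y) \<in> parcs G"
    using that by (auto dest: no_loops)
  then have Q_0: "Q (x # u) (y # v) 0 \<longleftrightarrow>
      (x, y) \<in> parcs G \<and> u = replicate t y \<and> v = replicate t x"
    unfolding const using True by (auto simp: Q_def shift)
  \<comment> \<open>The second disjunct of the claim does not mention \<open>words\<close>;
    membership follows from the arc and the constant tails.\<close>
  have words: "x \<in> pverts G \<and> y \<in> pverts G \<and> u \<in> words (pverts G) t \<and> v \<in> words (pverts G) t"
    if "Q (x # u) (y # v) 0"
    using that[unfolded Q_0] replicate_in_words in_arcsD1 in_arcsD2 by metis
  have "(x # u, y # v) \<in> parcs (sierpinski G (Suc t)) \<longleftrightarrow>
      (x \<in> pverts G \<and> u \<in> words (pverts G) t) \<and> (y \<in> pverts G \<and> v \<in> words (pverts G) t) \<and>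
      (Q (x # u) (y # v) 0 \<or> (\<exists>i<t. Q (x # u) (y # v) (Suc i)))"
    using True by (simp only: sierp length_Cons Cons_in_words_Suc Ex_less_Suc2)
  also have "\<dots> \<longleftrightarrow> ?rhs"
    unfolding Q_Suc Q_0[symmetric] sierp[OF conjunct1[OF True]] using words by blast
  finally show ?thesis .
next
  case False
  then show ?thesis
    by (auto simp: sierpinski_def words_def)
qed

lemma sierpinski_neighbours_Suc:
  assumes "x \<in> pverts G"
  shows "{w. (x # u, w) \<in> parcs (sierpinski G (Suc t))} =
     Cons x ` {v. (u, v) \<in> parcs (sierpinski G t)} \<union>
     (\<lambda>y. y # replicate t x) ` {y. (x, y) \<in> parcs G \<and> u = replicate t y}"
    (is "?N = ?L \<union> ?R")
proof (rule set_eqI)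
  fix w
  show "w \<in> ?N \<longleftrightarrow> w \<in> ?L \<union> ?R"
  proof (cases w)
    case Nil
    then show ?thesis
      by (auto simp: sierpinski_def words_def)
  next
    case (Cons y v)
    have "y # v \<in> ?L \<longleftrightarrow> x \<in> pverts G \<and> x = y \<and> (u, v) \<in> parcs (sierpinski G t)"
      using assms by blast
    moreover have "y # v \<in> ?R \<longleftrightarrow> (x, y) \<in> parcs G \<and> u = replicate t y \<and> v = replicate t x"
      by blast
    ultimately show ?thesis
      by (simp only: Cons Un_iff mem_Collect_eq Cons_parcs_sierpinski_Suc)
  qed
qed

text \<open>The old and new neighbours are disjoint: the old ones begin with \<open>x\<close>, the
  new ones with a neighbour of \<open>x\<close>, and there are no loops. For \<open>t = 0\<close>
  and \<open>u = []\<close> the last term counts all neighbours of \<open>x\<close>.\<close>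

lemma out_degree_sierpinski_Suc:
  assumes "x \<in> pverts G"
  shows "out_degree (with_proj (sierpinski G (Suc t))) (x # u) =
     out_degree (with_proj (sierpinski G t)) u + card {y. (x, y) \<in> parcs G \<and> u = replicate t y}"
proof -
  interpret S: pair_graph "sierpinski G t"
    by (rule pair_graph_sierpinski) unfold_locales
  have "finite {y. (x, y) \<in> parcs G \<and> u = replicate t y}"
    by (rule finite_subset[OF _ finite_neighbours[of x]]) auto
  moreover have "Cons x ` {v. (u, v) \<in> parcs (sierpinski G t)} \<inter>
     (\<lambda>y. y # replicate t x) ` {y. (x, y) \<in> parcs G \<and> u = replicate t y} = {}"
    by (auto dest: no_loops)
  ultimately show ?thesis
    unfolding out_degree_with_proj sierpinski_neighbours_Suc[OF assms]
    by (simp add: card_Un_disjoint card_image inj_on_def S.finite_neighbours)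
qed

text \<open>\<open>S(G, 0)\<close> has no arcs, so the whole degree comes from the new arcs.\<close>

lemma out_degree_sierpinski_1:
  assumes "x \<in> pverts G"
  shows "out_degree (with_proj (sierpinski G (Suc 0))) [x] = out_degree (with_proj G) x"
proof -
  have "out_degree (with_proj (sierpinski G 0)) [] = 0"
    by (simp add: out_degree_with_proj sierpinski_def)
  then show ?thesis
    using out_degree_sierpinski_Suc[OF assms, of 0 "[]"] by (simp add: out_degree_with_proj)
qed

text \<open>A nonempty constant word determines its letter.\<close>

lemma card_constant_word_neighbours:
  assumes "1 \<le> t"
  shows "card {y. (x, y) \<in> parcs G \<and> u = replicate t y} =
    (if \<exists>y. (x, y) \<in> parcs G \<and> u = replicate t y then 1 else 0)"
proof (cases "\<exists>y. (x, y) \<in> parcs G \<and> u = replicate t y")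
  case True
  then obtain y where "(x, y) \<in> parcs G" "u = replicate t y" by blast
  then have "{y. (x, y) \<in> parcs G \<and> u = replicate t y} = {y}"
    using assms by (auto simp: replicate_eq_replicate)
  with True show ?thesis by simp
next
  case False
  then have "{y. (x, y) \<in> parcs G \<and> u = replicate t y} = {}" by blast
  with False show ?thesis by (simp only: card.empty if_False)
qed

text \<open>Prepending \<open>y\<close> to a nonempty constant word of \<open>y\<close> could add a
  neighbour only through a loop at \<open>y\<close>.\<close>

lemma out_degree_sierpinski_replicate:
  assumes "y \<in> pverts G" and "1 \<le> t"
  shows "out_degree (with_proj (sierpinski G t)) (replicate t y) = out_degree (with_proj G) y"
  using \<open>1 \<le> t\<close>
proof (induction t rule: dec_induct)
  case base
  show ?case using out_degree_sierpinski_1[OF assms(1)] by simp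
next
  case (step t)
  have "{z. (y, z) \<in> parcs G \<and> replicate t y = replicate t z} = {}"
    using step.hyps by (auto simp: replicate_eq_replicate dest: no_loops)
  with out_degree_sierpinski_Suc[OF assms(1), of t "replicate t y"] step.IH show ?case
    by (simp only: card.empty replicate_Suc add_0_right)
qed

lemma leaves_sierpinski_Suc:
  assumes "1 \<le> t"
  shows "leaves (sierpinski G (Suc t)) =
    (\<lambda>(x, u). x # u) ` (pverts G \<times> leaves (sierpinski G t)) -
    (\<lambda>(y, x). x # replicate t y) ` (SIGMA y:leaves G. {x. (y, x) \<in> parcs G})"
proof -
  have "x # u \<in> leaves (sierpinski G (Suc t)) \<longleftrightarrow>
    u \<in> leaves (sierpinski G t) \<and> \<not> (\<exists>y. (x, y) \<in> parcs G \<and> u = replicate t y \<and> y \<in> leaves G)"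
    if x: "x \<in> pverts G" for x u
  proof (cases "\<exists>y. (x, y) \<in> parcs G \<and> u = replicate t y")
    case True
    then obtain y where y: "(x, y) \<in> parcs G" "u = replicate t y" by blast
    then have "y \<in> pverts G" by (auto dest: in_arcsD2)
    \<comment> \<open>Since \<open>y\<close> has the neighbour \<open>x\<close>, its degree plus one
      is at least 2, so \<open>x # u\<close> is not a leaf.\<close>
    moreover have "x \<in> {z. (y, z) \<in> parcs G}" using y arc_commute by simp
    then have "out_degree (with_proj G) y \<noteq> 0"
      unfolding out_degree_with_proj using finite_neighbours[of y] by auto
    moreover have "out_degree (with_proj (sierpinski G (Suc t))) (x # u) =
        out_degree (with_proj G) y + 1"
      using out_degree_sierpinski_Suc[OF x, of t u] True assms y \<open>y \<in> pverts G\<close>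
      by (simp only: card_constant_word_neighbours out_degree_sierpinski_replicate if_True)
    ultimately show ?thesis
      using x y assms
      by (auto simp: leaves_def pverts_sierpinski Cons_in_words_Suc
          out_degree_sierpinski_replicate)
  next
    case False
    then have "out_degree (with_proj (sierpinski G (Suc t))) (x # u) =
        out_degree (with_proj (sierpinski G t)) u"
      using out_degree_sierpinski_Suc[OF x, of t u] assms
      by (simp only: card_constant_word_neighbours if_False add_0_right)
    then show ?thesis
      using x False by (auto simp: leaves_def pverts_sierpinski Cons_in_words_Suc)
  qed
  \<comment> \<open>The equivalence above concerns words \<open>x # u\<close> only; every leaf has
    this form.\<close>
  moreover have "leaves (sierpinski G (Suc t)) \<subseteq> (\<lambda>(x, u). x # u) ` (pverts G \<times> UNIV)"
    by (auto simp: leaves_def pverts_sierpinski words_Suc)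
  ultimately show ?thesis
    by (auto simp: image_iff arc_commute)
qed

section \<open>Counting leaves\<close>

lemma finite_leaves: "finite (leaves G)"
  using pair_finite_verts by (simp add: leaves_def)

lemma num_leaves_sierpinski_1: "num_leaves (sierpinski G (Suc 0)) = num_leaves G"
proof -
  have "leaves (sierpinski G (Suc 0)) = (\<lambda>x. [x]) ` leaves G"
    by (auto simp: leaves_def pverts_sierpinski words_def length_Suc_conv
        out_degree_sierpinski_1 image_iff)
  then show ?thesis
    by (simp add: num_leaves_def card_image inj_on_def)
qed

text \<open>The sum form avoids truncated subtraction. \<open>A\<close> collects the leaves of all
  copies, \<open>B\<close> those destroyed by new arcs.\<close>

lemma num_leaves_sierpinski_Suc:
  assumes "1 \<le> t"
  shows "num_leaves (sierpinski G (Suc t)) + num_leaves G =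
    card (pverts G) * num_leaves (sierpinski G t)"
proof -
  define A where "A = (\<lambda>(x, u). x # u) ` (pverts G \<times> leaves (sierpinski G t))"
  define B where "B = (\<lambda>(y, x). x # replicate t y) ` (SIGMA y:leaves G. {x. (y, x) \<in> parcs G})"
  interpret S: pair_graph "sierpinski G t"
    by (rule pair_graph_sierpinski) unfold_locales
  have "card A = card (pverts G) * num_leaves (sierpinski G t)"
    unfolding A_def by (subst card_image) (auto simp: inj_on_def num_leaves_def card_cartesian_product)
  moreover have "card B = num_leaves G"
  proof -
    have "card B = card (SIGMA y:leaves G. {x. (y, x) \<in> parcs G})"
      unfolding B_def
      by (rule card_image) (use assms in \<open>auto simp: inj_on_def replicate_eq_replicate\<close>)
    also have "\<dots> = (\<Sum>y\<in>leaves G. out_degree (with_proj G) y)"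
      using finite_leaves finite_neighbours
      by (subst card_SigmaI) (auto simp: out_degree_with_proj)
    \<comment> \<open>Each summand is 1, as leaves have degree one.\<close>
    also have "\<dots> = num_leaves G"
      by (simp add: leaves_def num_leaves_def)
    finally show ?thesis .
  qed
  moreover have "B \<subseteq> A"
    using assms
    by (auto simp: A_def B_def leaves_def pverts_sierpinski replicate_in_words
        out_degree_sierpinski_replicate dest: in_arcsD2)
  moreover have "finite A"
    unfolding A_def using S.finite_leaves pair_finite_verts by simp
  moreover have "num_leaves (sierpinski G (Suc t)) = card (A - B)"
    by (simp only: num_leaves_def leaves_sierpinski_Suc[OF assms] A_def B_def)
  ultimately show ?thesis
    by (metis card_Diff_subset card_mono finite_subset le_add_diff_inverse2)
qed

text \<open>Multiplying out the denominator lets the induction run for every order, including 1. At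
  \<open>t = 1\<close> the last factor is \<open>n - 2 + 1 = n - 1\<close>.\<close>

lemma num_leaves_sierpinski_closed_form:
  assumes "1 \<le> t"
  shows "real (num_leaves (sierpinski G t)) * (real (card (pverts G)) - 1) =
    real (num_leaves G) *
      (real (card (pverts G)) ^ t - 2 * real (card (pverts G)) ^ (t - 1) + 1)"
  using assms
proof (induction t rule: dec_induct)
  case base
  show ?case by (simp add: num_leaves_sierpinski_1)
next
  case (step t)
  define n L where "n = real (card (pverts G))" and "L = real (num_leaves (sierpinski G t))"
  \<comment> \<open>This turns \<open>n * n ^ (t - 1)\<close> into \<open>n ^ t\<close>.\<close>
  obtain s where t: "t = Suc s" using step.hyps by (cases t) auto
  have "real (num_leaves (sierpinski G (Suc t))) = n * L - real (num_leaves G)"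
    using arg_cong[OF num_leaves_sierpinski_Suc[OF step.hyps(1)], of real]
    by (simp add: n_def L_def)
  moreover have "L * (n - 1) = real (num_leaves G) * (n ^ t - 2 * n ^ (t - 1) + 1)"
    using step.IH by (simp only: n_def L_def)
  ultimately have "real (num_leaves (sierpinski G (Suc t))) * (n - 1) =
      n * (real (num_leaves G) * (n ^ t - 2 * n ^ (t - 1) + 1)) - real (num_leaves G) * (n - 1)"
    by (simp add: left_diff_distrib mult.assoc)
  also have "\<dots> = real (num_leaves G) * (n ^ Suc t - 2 * n ^ t + 1)"
    by (simp add: t algebra_simps)
  finally show ?case by (simp add: n_def)
qed

lemma num_leaves_singleton:
  assumes "card (pverts G) = 1"
  shows "num_leaves G = 0"
proof -
  obtain a where "pverts G = {a}" using assms by (auto simp: card_1_singleton_iff)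
  then have "(v, w) \<notin> parcs G" for v w
    using in_arcsD1[of v w] in_arcsD2[of v w] no_loops[of "(v, w)"] by auto
  then show ?thesis
    by (simp add: num_leaves_def leaves_def out_degree_with_proj)
qed

end

theorem theorem4:
  fixes T :: "'a pair_pre_digraph" and n t :: nat
  assumes "undirected_tree T"
    and "card (pverts T) = n"
    and "1 \<le> t"
  shows "real (num_leaves (sierpinski T t)) =
    real (num_leaves T) * (real n ^ t - 2 * real n ^ (t - 1) + 1) / (real n - 1)"
\<comment> \<open>For \<open>n = 1\<close> the right side is a division by zero, hence 0 by
  convention. The left side is 0 too, since there is only one word of length
  \<open>t\<close>.\<close>
proof (cases "n = 1")
  case True
  interpret pair_graph T using assms(1) by (simp add: undirected_tree_def)
  interpret S: pair_graph "sierpinski T t"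
    by (rule pair_graph_sierpinski) unfold_locales
  have "card (words (pverts T) t) = 1"
    using card_lists_length_eq[of "pverts T" t] pair_finite_verts assms(2) True
    by (simp add: words_def conj_commute)
  then have "num_leaves (sierpinski T t) = 0"
    by (intro S.num_leaves_singleton) (simp add: pverts_sierpinski)
  then show ?thesis using True by simp
next
  case False
  interpret pair_graph T using assms(1) by (simp add: undirected_tree_def)
  show ?thesis
    using num_leaves_sierpinski_closed_form[OF assms(3)] assms(2) False
    by (simp add: field_simps)
qed

end
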